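(* Let $L$ be the algebraic closure of $\mathbb{Z}/(2)$, $A = L[x,y,z,t]/(z^4+xyz^2+x^3z+y^3z+t x^2y^2)$, $I=(x^4,y^4,z^4)\subseteq A$, $f=y^3z^3\in A$, and $S=L[t]\setminus\{0\}$. Then $f\in (S^{-1}I)^*$ in $S^{-1}A$.
   Context: For a commutative noetherian domain $R$ containing a field of characteristic $p>0$ and an ideal $I\subseteq R$, the tight closure of $I$ is $I^*=\{f\in R : \text{there exists } c\neq 0 \text{ in } R \text{ with } c f^{q}\in I^{[q]} \text{ for all } q=p^e,\ e\ge 0\}$, where $I^{[q]}$ is the ideal generated by all $q$-th powers of elements of $I$. *)

theory Defs
  imports "HOL-Algebra.Algebraic_Closure_Type" "HOL-Algebra.QuotRing" "HOL-Library.Z2"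
begin

section \<open>Tight closure\<close>

definition frobenius_power :: "('a, 'b) ring_scheme \<Rightarrow> 'a set \<Rightarrow> nat \<Rightarrow> 'a set" where
  "frobenius_power R I q = Idl\<^bsub>R\<^esub> {g [^]\<^bsub>R\<^esub> q | g. g \<in> I}"

text \<open>The notion is meant for a noetherian domain \<open>R\<close> containing a field of
  characteristic \<open>p\<close>.\<close>

definition tight_closure :: "nat \<Rightarrow> ('a, 'b) ring_scheme \<Rightarrow> 'a set \<Rightarrow> 'a set" where
  "tight_closure p R I =
     {f \<in> carrier R. \<exists>c \<in> carrier R. c \<noteq> \<zero>\<^bsub>R\<^esub> \<and>
        (\<forall>e::nat. c \<otimes>\<^bsub>R\<^esub> f [^]\<^bsub>R\<^esub> (p ^ e) \<in> frobenius_power R I (p ^ e))}"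


section \<open>Localization of a commutative ring\<close>

text \<open>A pair \<open>(r, s)\<close> stands for the fraction \<open>r / s\<close>; an element of the localization is an
  equivalence class of pairs. Zero divisors are allowed in \<open>S\<close>, hence the factor \<open>u\<close>.\<close>

definition loc_rel :: "('a, 'b) ring_scheme \<Rightarrow> 'a set \<Rightarrow> (('a \<times> 'a) \<times> ('a \<times> 'a)) set" where
  "loc_rel R S = {((r, s), (r', s')).
     r \<in> carrier R \<and> s \<in> S \<and> r' \<in> carrier R \<and> s' \<in> S \<and>
     (\<exists>u\<in>S. u \<otimes>\<^bsub>R\<^esub> (r \<otimes>\<^bsub>R\<^esub> s') = u \<otimes>\<^bsub>R\<^esub> (r' \<otimes>\<^bsub>R\<^esub> s))}"

definition loc_frac :: "('a, 'b) ring_scheme \<Rightarrow> 'a set \<Rightarrow> 'a \<Rightarrow> 'a \<Rightarrow> ('a \<times> 'a) set" where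
  "loc_frac R S r s = loc_rel R S `` {(r, s)}"

text \<open>The operations are independent of representatives, so each union below is that of
  a single class; see \<open>loc_mult_frac\<close> and \<open>loc_add_frac\<close>.\<close>

definition localization :: "('a, 'b) ring_scheme \<Rightarrow> 'a set \<Rightarrow> ('a \<times> 'a) set ring" where
  "localization R S =
    \<lparr>carrier = (carrier R \<times> S) // loc_rel R S,
     monoid.mult = (\<lambda>U V. \<Union>p\<in>U. \<Union>q\<in>V. loc_frac R S (fst p \<otimes>\<^bsub>R\<^esub> fst q) (snd p \<otimes>\<^bsub>R\<^esub> snd q)),
     one = loc_frac R S \<one>\<^bsub>R\<^esub> \<one>\<^bsub>R\<^esub>,
     ring.zero = loc_frac R S \<zero>\<^bsub>R\<^esub> \<one>\<^bsub>R\<^esub>,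
     add = (\<lambda>U V. \<Union>p\<in>U. \<Union>q\<in>V.
              loc_frac R S (fst p \<otimes>\<^bsub>R\<^esub> snd q \<oplus>\<^bsub>R\<^esub> fst q \<otimes>\<^bsub>R\<^esub> snd p) (snd p \<otimes>\<^bsub>R\<^esub> snd q))\<rparr>"

definition loc_ideal :: "('a, 'b) ring_scheme \<Rightarrow> 'a set \<Rightarrow> 'a set \<Rightarrow> ('a \<times> 'a) set set" where
  "loc_ideal R S I = {loc_frac R S a s | a s. a \<in> I \<and> s \<in> S}"

locale mult_subset = cring R for R (structure) +
  fixes S
  assumes S_sub: "S \<subseteq> carrier R"
    and one_S: "\<one> \<in> S"
    and mult_S: "s \<in> S \<Longrightarrow> s' \<in> S \<Longrightarrow> s \<otimes> s' \<in> S"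
begin

lemma S_carr [simp, intro]: "s \<in> S \<Longrightarrow> s \<in> carrier R"
  using S_sub by blast

declare one_S [simp, intro] mult_S [simp, intro]

lemma equiv_loc_rel: "equiv (carrier R \<times> S) (loc_rel R S)"
proof (rule equivI)
  show "loc_rel R S \<subseteq> (carrier R \<times> S) \<times> (carrier R \<times> S)"
    by (auto simp: loc_rel_def)
  show "refl_on (carrier R \<times> S) (loc_rel R S)"
    by (auto simp: refl_on_def loc_rel_def)
  show "sym (loc_rel R S)"
    unfolding sym_def loc_rel_def by (auto, metis)
  show "trans (loc_rel R S)"
  proof (rule transI)
    fix a b c assume ab: "(a, b) \<in> loc_rel R S" and bc: "(b, c) \<in> loc_rel R S"
    obtain r s r' s' r'' s'' where eq: "a = (r, s)" "b = (r', s')" "c = (r'', s'')"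
      by (metis surj_pair)
    from ab bc obtain u v where
      carr: "r \<in> carrier R" "s \<in> S" "r' \<in> carrier R" "s' \<in> S" "r'' \<in> carrier R" "s'' \<in> S"
      and u: "u \<in> S" "u \<otimes> (r \<otimes> s') = u \<otimes> (r' \<otimes> s)"
      and v: "v \<in> S" "v \<otimes> (r' \<otimes> s'') = v \<otimes> (r'' \<otimes> s')"
      unfolding eq loc_rel_def by auto
    note c = carr S_carr[OF carr(2)] S_carr[OF carr(4)] S_carr[OF carr(6)] S_carr[OF u(1)] S_carr[OF v(1)]
    have "(u \<otimes> v \<otimes> s') \<otimes> (r \<otimes> s'') = (v \<otimes> s'') \<otimes> (u \<otimes> (r \<otimes> s'))"
      using c by algebra
    also have "\<dots> = (u \<otimes> s) \<otimes> (v \<otimes> (r' \<otimes> s''))"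
      unfolding u(2) using c by algebra
    also have "\<dots> = (u \<otimes> v \<otimes> s') \<otimes> (r'' \<otimes> s)"
      unfolding v(2) using c by algebra
    finally show "(a, c) \<in> loc_rel R S"
      unfolding eq loc_rel_def using carr u(1) v(1) by blast
  qed
qed

lemma loc_frac_eq_iff:
  assumes "r \<in> carrier R" "s \<in> S" "r' \<in> carrier R" "s' \<in> S"
  shows "loc_frac R S r s = loc_frac R S r' s' \<longleftrightarrow> (\<exists>u\<in>S. u \<otimes> (r \<otimes> s') = u \<otimes> (r' \<otimes> s))"
proof -
  have "loc_frac R S r s = loc_frac R S r' s' \<longleftrightarrow> ((r, s), (r', s')) \<in> loc_rel R S"
    unfolding loc_frac_def using equiv_loc_rel assms by (intro eq_equiv_class_iff) auto
  thus ?thesis using assms by (auto simp: loc_rel_def)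
qed

lemma loc_carrier:
  "carrier (localization R S) = {loc_frac R S r s | r s. r \<in> carrier R \<and> s \<in> S}"
  by (auto simp: localization_def quotient_def loc_frac_def)

lemma loc_frac_closed [simp, intro]:
  "r \<in> carrier R \<Longrightarrow> s \<in> S \<Longrightarrow> loc_frac R S r s \<in> carrier (localization R S)"
  by (auto simp: loc_carrier)

lemma loc_frac_self: "r \<in> carrier R \<Longrightarrow> s \<in> S \<Longrightarrow> (r, s) \<in> loc_frac R S r s"
  by (auto simp: loc_frac_def loc_rel_def)

lemma loc_one: "\<one>\<^bsub>localization R S\<^esub> = loc_frac R S \<one> \<one>"
  and loc_zero: "\<zero>\<^bsub>localization R S\<^esub> = loc_frac R S \<zero> \<one>"
  by (simp_all add: localization_def)

lemma loc_union:
  assumes "\<And>p q. p \<in> U \<Longrightarrow> q \<in> V \<Longrightarrow> h p q = W" "U \<noteq> {}" "V \<noteq> {}"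
  shows "(\<Union>p\<in>U. \<Union>q\<in>V. h p q) = W"
  using assms by auto

lemma loc_mult_frac:
  assumes "r \<in> carrier R" "s \<in> S" "r' \<in> carrier R" "s' \<in> S"
  shows "loc_frac R S r s \<otimes>\<^bsub>localization R S\<^esub> loc_frac R S r' s' =
    loc_frac R S (r \<otimes> r') (s \<otimes> s')"
proof -
  have "(\<Union>p\<in>loc_frac R S r s. \<Union>q\<in>loc_frac R S r' s'.
      loc_frac R S (fst p \<otimes> fst q) (snd p \<otimes> snd q)) =
    loc_frac R S (r \<otimes> r') (s \<otimes> s')"
  proof (rule loc_union)
    fix p q assume p: "p \<in> loc_frac R S r s" and q: "q \<in> loc_frac R S r' s'"
    obtain a b a' b' where eq: "p = (a, b)" "q = (a', b')" by (metis surj_pair)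
    from p q obtain u v where carr: "a \<in> carrier R" "b \<in> S" "a' \<in> carrier R" "b' \<in> S"
      and u: "u \<in> S" "u \<otimes> (r \<otimes> b) = u \<otimes> (a \<otimes> s)"
      and v: "v \<in> S" "v \<otimes> (r' \<otimes> b') = v \<otimes> (a' \<otimes> s')"
      unfolding eq loc_frac_def loc_rel_def by auto
    note c = carr assms u(1) v(1) carr(2,4)[THEN S_carr] assms(2,4)[THEN S_carr]
      u(1)[THEN S_carr] v(1)[THEN S_carr]
    have "(u \<otimes> v) \<otimes> ((r \<otimes> r') \<otimes> (b \<otimes> b')) = (u \<otimes> (r \<otimes> b)) \<otimes> (v \<otimes> (r' \<otimes> b'))"
      using c by algebra
    also have "\<dots> = (u \<otimes> v) \<otimes> ((a \<otimes> a') \<otimes> (s \<otimes> s'))"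
      unfolding u(2) v(2) using c by algebra
    finally have "loc_frac R S (r \<otimes> r') (s \<otimes> s') = loc_frac R S (a \<otimes> a') (b \<otimes> b')"
      using c by (subst loc_frac_eq_iff) auto
    thus "loc_frac R S (fst p \<otimes> fst q) (snd p \<otimes> snd q) =
      loc_frac R S (r \<otimes> r') (s \<otimes> s')" by (simp add: eq)
  qed (use loc_frac_self assms in blast)+
  thus ?thesis by (simp add: localization_def)
qed

lemma loc_add_frac:
  assumes "r \<in> carrier R" "s \<in> S" "r' \<in> carrier R" "s' \<in> S"
  shows "loc_frac R S r s \<oplus>\<^bsub>localization R S\<^esub> loc_frac R S r' s' =
    loc_frac R S (r \<otimes> s' \<oplus> r' \<otimes> s) (s \<otimes> s')"
proof -
  have "(\<Union>p\<in>loc_frac R S r s. \<Union>q\<in>loc_frac R S r' s'.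
      loc_frac R S (fst p \<otimes> snd q \<oplus> fst q \<otimes> snd p) (snd p \<otimes> snd q)) =
    loc_frac R S (r \<otimes> s' \<oplus> r' \<otimes> s) (s \<otimes> s')"
  proof (rule loc_union)
    fix p q assume p: "p \<in> loc_frac R S r s" and q: "q \<in> loc_frac R S r' s'"
    obtain a b a' b' where eq: "p = (a, b)" "q = (a', b')" by (metis surj_pair)
    from p q obtain u v where carr: "a \<in> carrier R" "b \<in> S" "a' \<in> carrier R" "b' \<in> S"
      and u: "u \<in> S" "u \<otimes> (r \<otimes> b) = u \<otimes> (a \<otimes> s)"
      and v: "v \<in> S" "v \<otimes> (r' \<otimes> b') = v \<otimes> (a' \<otimes> s')"
      unfolding eq loc_frac_def loc_rel_def by auto
    note c = carr assms u(1) v(1) carr(2,4)[THEN S_carr] assms(2,4)[THEN S_carr]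
      u(1)[THEN S_carr] v(1)[THEN S_carr]
    have "(u \<otimes> v) \<otimes> ((r \<otimes> s' \<oplus> r' \<otimes> s) \<otimes> (b \<otimes> b')) =
        (v \<otimes> s' \<otimes> b') \<otimes> (u \<otimes> (r \<otimes> b)) \<oplus> (u \<otimes> s \<otimes> b) \<otimes> (v \<otimes> (r' \<otimes> b'))"
      using c by algebra
    also have "\<dots> = (u \<otimes> v) \<otimes> ((a \<otimes> b' \<oplus> a' \<otimes> b) \<otimes> (s \<otimes> s'))"
      unfolding u(2) v(2) using c by algebra
    finally have "loc_frac R S (r \<otimes> s' \<oplus> r' \<otimes> s) (s \<otimes> s') =
        loc_frac R S (a \<otimes> b' \<oplus> a' \<otimes> b) (b \<otimes> b')"
      using c by (subst loc_frac_eq_iff) auto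
    thus "loc_frac R S (fst p \<otimes> snd q \<oplus> fst q \<otimes> snd p) (snd p \<otimes> snd q) =
      loc_frac R S (r \<otimes> s' \<oplus> r' \<otimes> s) (s \<otimes> s')" by (simp add: eq)
  qed (use loc_frac_self assms in blast)+
  thus ?thesis by (simp add: localization_def)
qed

lemma cring_localization: "cring (localization R S)"
proof (rule cringI)
  show "abelian_group (localization R S)"
  proof (rule abelian_groupI)
    fix U V assume "U \<in> carrier (localization R S)" "V \<in> carrier (localization R S)"
    thus "U \<oplus>\<^bsub>localization R S\<^esub> V \<in> carrier (localization R S)"
      unfolding loc_carrier by (auto simp: loc_add_frac) (metis S_carr m_closed a_closed mult_S)
  next
    fix U V W assume "U \<in> carrier (localization R S)" "V \<in> carrier (localization R S)"
      "W \<in> carrier (localization R S)"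
    then obtain a b c r s t where eq: "U = loc_frac R S a r" "V = loc_frac R S b s" "W = loc_frac R S c t"
      and carr: "a \<in> carrier R" "b \<in> carrier R" "c \<in> carrier R" "r \<in> S" "s \<in> S" "t \<in> S"
      unfolding loc_carrier by blast
    note c = carr carr(4-6)[THEN S_carr]
    have "(a \<otimes> s \<oplus> b \<otimes> r) \<otimes> t \<oplus> c \<otimes> (r \<otimes> s) = a \<otimes> (s \<otimes> t) \<oplus> (b \<otimes> t \<oplus> c \<otimes> s) \<otimes> r"
      using c by algebra
    thus "U \<oplus>\<^bsub>localization R S\<^esub> V \<oplus>\<^bsub>localization R S\<^esub> W =
          U \<oplus>\<^bsub>localization R S\<^esub> (V \<oplus>\<^bsub>localization R S\<^esub> W)"
      unfolding eq using c by (simp add: loc_add_frac m_assoc)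
  next
    fix U V assume "U \<in> carrier (localization R S)" "V \<in> carrier (localization R S)"
    then obtain a b r s where eq: "U = loc_frac R S a r" "V = loc_frac R S b s"
      and carr: "a \<in> carrier R" "b \<in> carrier R" "r \<in> S" "s \<in> S"
      unfolding loc_carrier by blast
    thus "U \<oplus>\<^bsub>localization R S\<^esub> V = V \<oplus>\<^bsub>localization R S\<^esub> U"
      by (simp add: loc_add_frac a_comm m_comm)
  next
    fix U assume "U \<in> carrier (localization R S)"
    then obtain a r where eq: "U = loc_frac R S a r" and carr: "a \<in> carrier R" "r \<in> S"
      unfolding loc_carrier by blast
    show "\<zero>\<^bsub>localization R S\<^esub> \<oplus>\<^bsub>localization R S\<^esub> U = U"
      using carr by (simp add: eq loc_zero loc_add_frac)
    have "loc_frac R S (\<ominus> a) r \<oplus>\<^bsub>localization R S\<^esub> U = \<zero>\<^bsub>localization R S\<^esub>"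
      using carr
      by (simp add: eq loc_zero loc_add_frac loc_frac_eq_iff l_minus l_neg)
         (use one_S in blast)
    thus "\<exists>V\<in>carrier (localization R S). V \<oplus>\<^bsub>localization R S\<^esub> U = \<zero>\<^bsub>localization R S\<^esub>"
      using carr by blast
  qed (auto simp: loc_zero)
next
  show "Group.comm_monoid (localization R S)"
  proof (rule comm_monoidI)
    fix U V assume "U \<in> carrier (localization R S)" "V \<in> carrier (localization R S)"
    thus "U \<otimes>\<^bsub>localization R S\<^esub> V \<in> carrier (localization R S)"
      unfolding loc_carrier by (auto simp: loc_mult_frac) (metis S_carr m_closed mult_S)
  next
    fix U V W assume "U \<in> carrier (localization R S)" "V \<in> carrier (localization R S)"
      "W \<in> carrier (localization R S)"
    thus "U \<otimes>\<^bsub>localization R S\<^esub> V \<otimes>\<^bsub>localization R S\<^esub> W =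
          U \<otimes>\<^bsub>localization R S\<^esub> (V \<otimes>\<^bsub>localization R S\<^esub> W)"
      unfolding loc_carrier by (auto simp: loc_mult_frac m_assoc)
  next
    fix U V assume "U \<in> carrier (localization R S)" "V \<in> carrier (localization R S)"
    thus "U \<otimes>\<^bsub>localization R S\<^esub> V = V \<otimes>\<^bsub>localization R S\<^esub> U"
      unfolding loc_carrier by (auto simp: loc_mult_frac m_comm)
  next
    fix U assume "U \<in> carrier (localization R S)"
    thus "\<one>\<^bsub>localization R S\<^esub> \<otimes>\<^bsub>localization R S\<^esub> U = U"
      unfolding loc_carrier by (auto simp: loc_mult_frac loc_one)
  qed (auto simp: loc_one)
next
  fix U V W assume "U \<in> carrier (localization R S)" "V \<in> carrier (localization R S)"
    "W \<in> carrier (localization R S)"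
  then obtain a b c r s t where eq: "U = loc_frac R S a r" "V = loc_frac R S b s" "W = loc_frac R S c t"
    and carr: "a \<in> carrier R" "b \<in> carrier R" "c \<in> carrier R" "r \<in> S" "s \<in> S" "t \<in> S"
    unfolding loc_carrier by blast
  note c = carr carr(4-6)[THEN S_carr]
  have "\<one> \<otimes> ((a \<otimes> s \<oplus> b \<otimes> r) \<otimes> c \<otimes> (r \<otimes> t \<otimes> (s \<otimes> t))) =
        \<one> \<otimes> ((a \<otimes> c \<otimes> (s \<otimes> t) \<oplus> b \<otimes> c \<otimes> (r \<otimes> t)) \<otimes> (r \<otimes> s \<otimes> t))"
    using c by algebra
  hence "loc_frac R S ((a \<otimes> s \<oplus> b \<otimes> r) \<otimes> c) (r \<otimes> s \<otimes> t) =
        loc_frac R S (a \<otimes> c \<otimes> (s \<otimes> t) \<oplus> b \<otimes> c \<otimes> (r \<otimes> t)) (r \<otimes> t \<otimes> (s \<otimes> t))"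
    using c by (subst loc_frac_eq_iff) (auto intro!: bexI[OF _ one_S])
  thus "(U \<oplus>\<^bsub>localization R S\<^esub> V) \<otimes>\<^bsub>localization R S\<^esub> W =
    U \<otimes>\<^bsub>localization R S\<^esub> W \<oplus>\<^bsub>localization R S\<^esub> V \<otimes>\<^bsub>localization R S\<^esub> W"
    unfolding eq using c by (simp add: loc_add_frac loc_mult_frac)
qed

end


section \<open>The ring \<open>A\<close>, the ideal \<open>I\<close>, the element \<open>f\<close> and the multiplicative set \<open>S\<close>\<close>

type_synonym L = "bit alg_closure"

text \<open>The polynomial ring \<open>L[x,y,z,t]\<close> is \<open>L[t][x][y][z]\<close>, with \<open>t\<close> the innermost variable.\<close>

type_synonym Lxyzt = "L poly poly poly poly"

definition tv :: Lxyzt where "tv = [:[:[:[:0, 1:]:]:]:]"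
definition xv :: Lxyzt where "xv = [:[:[:0, 1:]:]:]"
definition yv :: Lxyzt where "yv = [:[:0, 1:]:]"
definition zv :: Lxyzt where "zv = [:0, 1:]"

definition const_t :: "L poly \<Rightarrow> Lxyzt" where
  "const_t g = [:[:[:g:]:]:]"

definition rel_poly :: Lxyzt where
  "rel_poly = zv^4 + xv * yv * zv^2 + xv^3 * zv + yv^3 * zv + tv * xv^2 * yv^2"

definition rel_ideal :: "Lxyzt set" where
  "rel_ideal = Idl\<^bsub>ring_of_type_algebra\<^esub> {rel_poly}"

definition A_ring :: "Lxyzt set ring" where
  "A_ring = ring_of_type_algebra Quot rel_ideal"

definition cls :: "Lxyzt \<Rightarrow> Lxyzt set" where
  "cls g = rel_ideal +>\<^bsub>ring_of_type_algebra\<^esub> g"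

definition I_A :: "Lxyzt set set" where
  "I_A = Idl\<^bsub>A_ring\<^esub>
     {cls xv [^]\<^bsub>A_ring\<^esub> (4::nat), cls yv [^]\<^bsub>A_ring\<^esub> (4::nat), cls zv [^]\<^bsub>A_ring\<^esub> (4::nat)}"

definition f_A :: "Lxyzt set" where
  "f_A = cls yv [^]\<^bsub>A_ring\<^esub> (3::nat) \<otimes>\<^bsub>A_ring\<^esub> cls zv [^]\<^bsub>A_ring\<^esub> (3::nat)"

definition S_A :: "Lxyzt set set" where
  "S_A = {cls (const_t g) | g. g \<noteq> 0}"

text \<open>\<open>A\<close> is a commutative ring, \<open>S\<close> is multiplicative in it and avoids \<open>0\<close> (the
  relation is monic of degree 4 in \<open>z\<close>).\<close>

lemma ideal_rel_ideal: "ideal rel_ideal (ring_of_type_algebra :: Lxyzt ring)"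
  unfolding rel_ideal_def
  by (rule ring.genideal_ideal[OF ring_from_type_algebra]) (simp add: ring_of_type_algebra_def)

lemma cring_A_ring: "cring A_ring"
  unfolding A_ring_def
  by (rule ideal.quotient_is_cring[OF ideal_rel_ideal cring_from_type_algebra])

lemma cls_ring_hom: "cls \<in> ring_hom (ring_of_type_algebra :: Lxyzt ring) A_ring"
proof -
  have "cls = (+>\<^bsub>ring_of_type_algebra\<^esub>) rel_ideal"
    by (rule ext) (simp add: cls_def)
  thus ?thesis unfolding A_ring_def using ideal.rcos_ring_hom[OF ideal_rel_ideal] by simp
qed

lemma cls_mult: "cls g \<otimes>\<^bsub>A_ring\<^esub> cls h = cls (g * h)"
  using ring_hom_mult[OF cls_ring_hom, of g h] by (simp add: ring_of_type_algebra_def)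

lemma cls_one: "\<one>\<^bsub>A_ring\<^esub> = cls 1"
  using ring_hom_one[OF cls_ring_hom] by (simp add: ring_of_type_algebra_def)

lemma cls_closed [simp, intro]: "cls g \<in> carrier A_ring"
  using ring_hom_closed[OF cls_ring_hom, of g] by (simp add: ring_of_type_algebra_def)

lemma mult_subset_S_A: "mult_subset A_ring S_A"
proof (intro mult_subset.intro mult_subset_axioms.intro cring_A_ring)
  show "S_A \<subseteq> carrier A_ring" by (auto simp: S_A_def)
  have "const_t 1 = 1" by (simp add: const_t_def one_pCons)
  thus "\<one>\<^bsub>A_ring\<^esub> \<in> S_A" unfolding S_A_def cls_one
    by (metis (mono_tags, lifting) mem_Collect_eq one_neq_zero)
next
  fix s s' assume "s \<in> S_A" "s' \<in> S_A"
  then obtain g h where "s = cls (const_t g)" "s' = cls (const_t h)" "g \<noteq> 0" "h \<noteq> 0"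
    by (auto simp: S_A_def)
  moreover have "const_t g * const_t h = const_t (g * h)" by (simp add: const_t_def)
  ultimately show "s \<otimes>\<^bsub>A_ring\<^esub> s' \<in> S_A"
    unfolding S_A_def by (auto simp: cls_mult intro!: exI[of _ "g * h"])
qed

lemma mem_rel_ideal_iff: "g \<in> rel_ideal \<longleftrightarrow> rel_poly dvd g"
proof -
  have "rel_ideal = PIdl\<^bsub>ring_of_type_algebra\<^esub> rel_poly"
    unfolding rel_ideal_def
    by (rule cring.cgenideal_eq_genideal[OF cring_from_type_algebra, symmetric])
       (simp add: ring_of_type_algebra_def)
  thus ?thesis by (auto simp: cgenideal_def ring_of_type_algebra_def dvd_def mult.commute)
qed

lemma cls_eq_zero_iff: "cls g = \<zero>\<^bsub>A_ring\<^esub> \<longleftrightarrow> rel_poly dvd g"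
proof -
  interpret ideal rel_ideal "ring_of_type_algebra :: Lxyzt ring" by (rule ideal_rel_ideal)
  have "cls g = rel_ideal \<longleftrightarrow> g \<in> rel_ideal"
    unfolding cls_def using a_rcos_self[of g] a_rcos_const[of g] by (auto simp: ring_of_type_algebra_def)
  thus ?thesis by (simp add: A_ring_def FactRing_def mem_rel_ideal_iff)
qed

lemma degree_rel_poly: "Polynomial.degree rel_poly = 4"
  by (simp add: rel_poly_def zv_def xv_def yv_def tv_def power4_eq_xxxx power3_eq_cube
      power2_eq_square)

lemma zero_notin_S_A: "\<zero>\<^bsub>A_ring\<^esub> \<notin> S_A"
proof
  assume "\<zero>\<^bsub>A_ring\<^esub> \<in> S_A"
  then obtain g where g: "g \<noteq> 0" "cls (const_t g) = \<zero>\<^bsub>A_ring\<^esub>" by (auto simp: S_A_def)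
  hence "rel_poly dvd const_t g" by (simp add: cls_eq_zero_iff)
  from dvd_imp_degree_le[OF this] g show False
    by (simp add: degree_rel_poly const_t_def)
qed

end

theory Submission
  imports Defs
begin

text \<open>Let \<open>q = 2\<^sup>n\<close>. The relation is additive in \<open>z\<close>, so
  \<open>z\<^sup>4\<^sup>q = A z\<^sup>2 + B z + C\<close> in \<open>A\<close> with \<open>A, B, C\<close> free of \<open>z\<close>. Multiplication by \<open>x\<^sup>3 + y\<^sup>3\<close>
  moves \<open>A\<close> and \<open>B\<close> into \<open>(x\<^sup>4\<^sup>q, y\<^sup>4\<^sup>q)\<close>, hence \<open>(x\<^sup>3 + y\<^sup>3) C\<close> lies in
  \<open>J = (x\<^sup>4\<^sup>q, y\<^sup>4\<^sup>q, z\<^sup>4\<^sup>q)\<close>. The term of highest degree in \<open>t\<close> of \<open>C\<close> is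
  \<open>t\<^sup>q x\<^sup>2\<^sup>q y\<^sup>2\<^sup>q\<close>; therefore the finite \<open>GF(2)\<close>-span of the monomials \<open>t\<^sup>k x\<^sup>i y\<^sup>j\<close> with \<open>k < q\<close> and
  \<open>i + j = 6q + 2\<close> is stable under multiplication by \<open>t\<close> modulo \<open>J\<close>. By the pigeonhole
  principle some \<open>t\<^sup>a + t\<^sup>b\<close> with \<open>a < b\<close> carries a given such monomial into \<open>J\<close>. So forms of degree
  \<open>6q + 2\<close> in \<open>x, y\<close>, and then all monomials of degree at least \<open>6q + 5\<close> in \<open>x, y, z\<close>, lie in
  \<open>S\<^sup>-\<^sup>1J\<close>, and \<open>c = x\<^sup>5\<close> works for all \<open>q\<close>.\<close>

section \<open>Sums of monomials in characteristic two\<close>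

text \<open>In characteristic 2 this is the span over the prime field, which is why it is finite.\<close>

inductive_set bisums :: "'a::comm_ring_1 \<Rightarrow> 'a \<Rightarrow> 'a \<Rightarrow> nat \<Rightarrow> nat \<Rightarrow> 'a set"
  for x y t K d where
  zero: "0 \<in> bisums x y t K d"
| monom_add: "v \<in> bisums x y t K d \<Longrightarrow> k \<le> K \<Longrightarrow> i + j = d \<Longrightarrow> t ^ k * x ^ i * y ^ j + v \<in> bisums x y t K d"

lemma monom_in_bisums: "k \<le> K \<Longrightarrow> i + j = d \<Longrightarrow> t ^ k * x ^ i * y ^ j \<in> bisums x y t K d"
  using bisums.monom_add[OF bisums.zero] by (metis add.right_neutral)

lemma bisums_add: "u \<in> bisums x y t K d \<Longrightarrow> v \<in> bisums x y t K d \<Longrightarrow> u + v \<in> bisums x y t K d"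
  by (induction rule: bisums.induct) (auto intro: bisums.monom_add simp: add.assoc)

lemma bisums_mono: "u \<in> bisums x y t K d \<Longrightarrow> K \<le> K' \<Longrightarrow> d = d' \<Longrightarrow> u \<in> bisums x y t K' d'"
  by (induction rule: bisums.induct) (auto intro: bisums.intros)

lemma monom_mult_bisums:
  assumes "v \<in> bisums x y t K' d'" "k \<le> K" "i + j = d"
  shows "t ^ k * x ^ i * y ^ j * v \<in> bisums x y t (K + K') (d + d')"
  using assms(1)
proof induction
  case zero
  show ?case by (simp add: bisums.zero)
next
  case (monom_add v k' i' j')
  have "t ^ k * x ^ i * y ^ j * (t ^ k' * x ^ i' * y ^ j' + v)
      = t ^ (k + k') * x ^ (i + i') * y ^ (j + j') + t ^ k * x ^ i * y ^ j * v"
    by (simp add: power_add algebra_simps)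
  thus ?case using monom_add assms(2,3) by (auto intro!: bisums.monom_add)
qed

lemma bisums_mult:
  assumes "u \<in> bisums x y t K d" "v \<in> bisums x y t K' d'"
  shows "u * v \<in> bisums x y t (K + K') (d + d')"
  using assms(1)
  by induction (auto simp: bisums.zero distrib_right intro!: bisums_add monom_mult_bisums assms(2))

lemma double_eq_0:
  assumes "1 + 1 = (0 :: 'a :: comm_ring_1)"
  shows "(a :: 'a) + a = 0"
  using assms by (metis distrib_left mult.right_neutral mult_zero_right)

lemma double_left:
  assumes "1 + 1 = (0 :: 'a :: comm_ring_1)"
  shows "(a :: 'a) + (a + b) = b"
  using double_eq_0[OF assms, of a] by (simp flip: add.assoc)

text \<open>Adding a monomial that already occurs cancels it, so every element is the sum of a
  subset of the finite set \<open>M\<close> of monomials.\<close>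

lemma finite_bisums:
  assumes two: "1 + 1 = (0 :: 'a :: comm_ring_1)"
  shows "finite (bisums (x :: 'a) y t K d)"
proof -
  define M where "M = (\<lambda>(k, i, j). t ^ k * x ^ i * y ^ j) ` ({..K} \<times> {..d} \<times> {..d})"
  have fin: "finite M" by (simp add: M_def)
  have "v \<in> sum (\<lambda>m. m) ` Pow M" if "v \<in> bisums x y t K d" for v
    using that
  proof induction
    case zero
    show ?case by (rule image_eqI[of _ _ "{}"]) auto
  next
    case (monom_add v k i j)
    define m where "m = t ^ k * x ^ i * y ^ j"
    have m: "m \<in> M" unfolding m_def M_def using monom_add by force
    obtain T where T: "T \<subseteq> M" "v = \<Sum>T" using monom_add by auto
    have fT: "finite T" using T fin finite_subset by blast
    show ?case unfolding m_def[symmetric]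
    proof (cases "m \<in> T")
      case True
      hence "m + v = \<Sum>(T - {m})" using T fT double_left[OF two, of m]
        by (simp add: sum.remove[OF fT True])
      thus "m + v \<in> sum (\<lambda>m. m) ` Pow M" using T by blast
    next
      case False
      hence "m + v = \<Sum>(insert m T)" using T fT by simp
      thus "m + v \<in> sum (\<lambda>m. m) ` Pow M" using T m by blast
    qed
  qed
  thus ?thesis using fin by (meson finite_Pow_iff finite_imageI finite_subset subsetI)
qed

section \<open>Powers of \<open>z\<close> modulo the quartic\<close>

text \<open>The two elements of the unordered pair trade places at each Frobenius step.\<close>

lemma quartic_power_expansion:
  fixes x y z t :: "'a :: comm_ring_1"
  assumes two: "1 + 1 = (0 :: 'a)"
  defines "r \<equiv> z^4 + x * y * z^2 + x^3 * z + y^3 * z + t * x^2 * y^2"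
  shows "\<exists>A B D. A \<in> bisums x y t 0 (4 * 2^n - 2) \<and> B \<in> bisums x y t 0 (4 * 2^n - 1) \<and>
    D \<in> bisums x y t (2^n - 1) (4 * 2^n) \<and>
    {x^2 * A + y * B, y^2 * A + x * B} = {x ^ (4 * 2^n), y ^ (4 * 2^n)} \<and>
    r dvd z ^ (4 * 2^n) + A * z^2 + B * z + (t ^ 2^n * x ^ (2 * 2^n) * y ^ (2 * 2^n) + D)"
proof (induction n)
  case 0
  note char2 = double_eq_0[OF two] double_left[OF two]
  have "x * y \<in> bisums x y t 0 2" using monom_in_bisums[of 0 0 1 1 2 t x y] by simp
  moreover have "x^3 \<in> bisums x y t 0 3" "y^3 \<in> bisums x y t 0 3"
    using monom_in_bisums[of 0 0 3 0 3 t x y] monom_in_bisums[of 0 0 0 3 3 t x y] by auto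
  hence "x^3 + y^3 \<in> bisums x y t 0 3" by (rule bisums_add)
  moreover have "x^2 * (x * y) + y * (x^3 + y^3) = y^4" "y^2 * (x * y) + x * (x^3 + y^3) = x^4"
    by (simp_all add: char2 algebra_simps eval_nat_numeral)
  moreover have "r dvd z^4 + x * y * z^2 + (x^3 + y^3) * z + (t * x^2 * y^2 + 0)"
    unfolding r_def by (simp add: algebra_simps)
  ultimately show ?case
    by (intro exI[of _ "x * y"] exI[of _ "x^3 + y^3"] exI[of _ 0]) (auto simp: bisums.zero)
next
  case (Suc n)
  note char2 = double_eq_0[OF two] double_left[OF two]
  define q :: nat where "q = 2 ^ n"
  have q: "q \<ge> 1" by (simp add: q_def)
  have double: "2 ^ Suc n = 2 * q" "4 * (2 * q) = 8 * q" "2 * (2 * q) = 4 * q" by (auto simp: q_def)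
  from Suc obtain A B D where A: "A \<in> bisums x y t 0 (4 * q - 2)" and B: "B \<in> bisums x y t 0 (4 * q - 1)"
    and D: "D \<in> bisums x y t (q - 1) (4 * q)"
    and set: "{x^2 * A + y * B, y^2 * A + x * B} = {x ^ (4 * q), y ^ (4 * q)}"
    and dvd: "r dvd z ^ (4 * q) + A * z^2 + B * z + (t ^ q * x ^ (2 * q) * y ^ (2 * q) + D)"
    unfolding q_def by blast
  have AA: "A * A \<in> bisums x y t 0 (8 * q - 4)"
    by (rule bisums_mono[OF bisums_mult[OF A A]]) auto
  have BB: "B * B \<in> bisums x y t 0 (8 * q - 2)"
    by (rule bisums_mono[OF bisums_mult[OF B B]]) auto
  have DD: "D * D \<in> bisums x y t (2 * q - 1) (8 * q)"
    by (rule bisums_mono[OF bisums_mult[OF D D]]) auto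
  have mon: "x * y \<in> bisums x y t 0 2" "x^3 \<in> bisums x y t 0 3" "y^3 \<in> bisums x y t 0 3"
      "t * x^2 * y^2 \<in> bisums x y t 1 4"
    using monom_in_bisums[of 0 0 1 1 2 t x y] monom_in_bisums[of 0 0 3 0 3 t x y]
      monom_in_bisums[of 0 0 0 3 3 t x y] monom_in_bisums[of 1 1 2 2 4 t x y] by auto
  have e: "x^3 + y^3 \<in> bisums x y t 0 3" using mon by (intro bisums_add)
  have A': "x * y * (A * A) + B * B \<in> bisums x y t 0 (8 * q - 2)"
    using q by (intro bisums_add BB bisums_mono[OF bisums_mult[OF mon(1) AA]]) auto
  have B': "(x^3 + y^3) * (A * A) \<in> bisums x y t 0 (8 * q - 1)"
    using q by (intro bisums_mono[OF bisums_mult[OF e AA]]) auto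
  \<comment> \<open>The exponent of \<open>t\<close> must stay below that of the new leading term,
    \<open>2 * q\<close>: squaring gives at most \<open>2 * q - 2\<close>, and the extra factor
    \<open>t\<close> gives 1, which is admissible because \<open>q \<ge> 1\<close>.\<close>
  have D': "D * D + t * x^2 * y^2 * (A * A) \<in> bisums x y t (2 * q - 1) (8 * q)"
    using q by (intro bisums_add DD bisums_mono[OF bisums_mult[OF mon(4) AA]]) auto
  \<comment> \<open>The mixed terms in \<open>A * A\<close> occur twice and cancel, leaving the
    square of the other old entry.\<close>
  have "x^2 * (x * y * (A * A) + B * B) + y * ((x^3 + y^3) * (A * A)) = (y^2 * A + x * B)^2"
    "y^2 * (x * y * (A * A) + B * B) + x * ((x^3 + y^3) * (A * A)) = (x^2 * A + y * B)^2"
    by (simp_all add: char2 algebra_simps eval_nat_numeral)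
  hence "{x^2 * (x * y * (A * A) + B * B) + y * ((x^3 + y^3) * (A * A)),
      y^2 * (x * y * (A * A) + B * B) + x * ((x^3 + y^3) * (A * A))} =
      (\<lambda>a. a^2) ` {x^2 * A + y * B, y^2 * A + x * B}" by auto
  hence set': "{x^2 * (x * y * (A * A) + B * B) + y * ((x^3 + y^3) * (A * A)),
      y^2 * (x * y * (A * A) + B * B) + x * ((x^3 + y^3) * (A * A))} = {x ^ (8 * q), y ^ (8 * q)}"
    unfolding set by (simp add: mult.commute flip: power_mult)
  have dvd': "r dvd z ^ (8 * q) + (x * y * (A * A) + B * B) * z^2 + (x^3 + y^3) * (A * A) * z
      + (t ^ (2 * q) * x ^ (4 * q) * y ^ (4 * q) + (D * D + t * x^2 * y^2 * (A * A)))"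
  proof -
    define Z where "Z = z ^ (4 * q)"
    define C where "C = t ^ q * x ^ (2 * q) * y ^ (2 * q)"
    have ZC: "z ^ (8 * q) = Z^2" "t ^ (2 * q) * x ^ (4 * q) * y ^ (4 * q) = C^2"
      by (simp_all add: Z_def C_def power_mult_distrib mult.commute flip: power_mult)
    \<comment> \<open>Squaring is additive here, so the old relation squared contains
      \<open>A^2 * z^4\<close>; adding \<open>A^2 * r\<close> replaces this \<open>z^4\<close> by
      terms of degree at most 2 in \<open>z\<close>.\<close>
    have "Z^2 + (x * y * (A * A) + B * B) * z^2 + (x^3 + y^3) * (A * A) * z
        + (C^2 + (D * D + t * x^2 * y^2 * (A * A)))
      = (Z + A * z^2 + B * z + (C + D))^2 + A^2 * r"
      unfolding r_def by (simp add: char2 algebra_simps eval_nat_numeral)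
    moreover have "r dvd (Z + A * z^2 + B * z + (C + D))^2 + A^2 * r"
      using dvd unfolding Z_def C_def by (simp add: power2_eq_square)
    ultimately show ?thesis unfolding ZC by simp
  qed
  show ?case unfolding double using A' B' D' set' dvd' by blast
qed

section \<open>Torsion modulo the Frobenius power\<close>

text \<open>\<open>J\<close> models the preimage, in the polynomial ring, of the Frobenius power of
  the ideal; hence it contains the quartic itself. \<open>S\<close> models the nonzero polynomials
  in \<open>t\<close>.\<close>

locale quartic_frobenius_ideal =
  fixes x y z t :: "'a :: comm_ring_1" and J S :: "'a set" and n :: nat
  assumes two: "1 + 1 = (0 :: 'a)"
    and zero_J: "0 \<in> J"
    and add_J: "u \<in> J \<Longrightarrow> v \<in> J \<Longrightarrow> u + v \<in> J"
    and mult_J: "v \<in> J \<Longrightarrow> a * v \<in> J"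
    and powers_J: "x ^ (4 * 2^n) \<in> J" "y ^ (4 * 2^n) \<in> J" "z ^ (4 * 2^n) \<in> J"
    and rel_J: "z^4 + x * y * z^2 + x^3 * z + y^3 * z + t * x^2 * y^2 \<in> J"
    and mult_S: "g \<in> S \<Longrightarrow> h \<in> S \<Longrightarrow> g * h \<in> S"
    and binomial_S: "i < j \<Longrightarrow> t ^ i + t ^ j \<in> S"
begin

lemmas char2 = double_eq_0[OF two] double_left[OF two]

lemma mult_J': "v \<in> J \<Longrightarrow> v * a \<in> J"
  by (metis mult_J mult.commute)

lemma dvd_J: "v \<in> J \<Longrightarrow> v dvd w \<Longrightarrow> w \<in> J"
  by (auto simp: dvd_def mult_J')

lemma leading_term_J:
  obtains D where "D \<in> bisums x y t (2^n - 1) (4 * 2^n)"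
    "(x^3 + y^3) * (t ^ 2^n * x ^ (2 * 2^n) * y ^ (2 * 2^n) + D) \<in> J"
proof -
  from quartic_power_expansion[OF two, of x y t n z] obtain A B D where
    D: "D \<in> bisums x y t (2^n - 1) (4 * 2^n)" and
    set: "{x^2 * A + y * B, y^2 * A + x * B} = {x ^ (4 * 2^n), y ^ (4 * 2^n)}" and
    dvd: "z^4 + x * y * z^2 + x^3 * z + y^3 * z + t * x^2 * y^2 dvd
      z ^ (4 * 2^n) + A * z^2 + B * z + (t ^ 2^n * x ^ (2 * 2^n) * y ^ (2 * 2^n) + D)"
    by blast
  define U W C where "U = x^2 * A + y * B" and "W = y^2 * A + x * B"
    and "C = t ^ 2^n * x ^ (2 * 2^n) * y ^ (2 * 2^n) + D"
  have UW: "U \<in> J" "W \<in> J"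
    using set powers_J unfolding U_def[symmetric] W_def[symmetric] by (auto simp: doubleton_eq_iff)
  \<comment> \<open>Cramer's rule: \<open>U\<close> and \<open>W\<close> are linear in
    \<open>A\<close> and \<open>B\<close>, and the determinant of this system is
    \<open>x^3 + y^3\<close> in characteristic 2.\<close>
  have "(x^3 + y^3) * A = x * U + y * W" "(x^3 + y^3) * B = x^2 * W + y^2 * U"
    by (simp_all add: U_def W_def char2 algebra_simps eval_nat_numeral)
  hence AB: "(x^3 + y^3) * A \<in> J" "(x^3 + y^3) * B \<in> J"
    using UW by (auto intro!: add_J mult_J)
  have rel: "z ^ (4 * 2^n) + A * z^2 + B * z + C \<in> J"
    using dvd_J[OF rel_J dvd] by (simp add: C_def)
  have "(x^3 + y^3) * (z ^ (4 * 2^n) + A * z^2 + B * z + C)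
      + ((x^3 + y^3) * z ^ (4 * 2^n) + (x^3 + y^3) * A * z^2 + (x^3 + y^3) * B * z) \<in> J"
    by (intro add_J mult_J'[OF AB(1)] mult_J'[OF AB(2)] mult_J[OF powers_J(3)] mult_J[OF rel])
  also have "(x^3 + y^3) * (z ^ (4 * 2^n) + A * z^2 + B * z + C)
      + ((x^3 + y^3) * z ^ (4 * 2^n) + (x^3 + y^3) * A * z^2 + (x^3 + y^3) * B * z) = (x^3 + y^3) * C"
    by (simp add: char2 algebra_simps)
  finally show ?thesis using that D unfolding C_def by blast
qed

text \<open>In characteristic 2, \<open>u + v \<in> J\<close> expresses congruence modulo
  \<open>J\<close>. Up to lower powers of \<open>t\<close>, the relation of
  \<open>leading_term_J\<close> trades \<open>x^3\<close> for \<open>y^3\<close>; repeating this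
  lowers \<open>i\<close> until a monomial lies in \<open>J\<close>.\<close>

lemma reduce_monom:
  assumes "i + j = 6 * 2^n + 2"
  shows "\<exists>v \<in> bisums x y t (2^n - 1) (6 * 2^n + 2). t ^ 2^n * x ^ i * y ^ j + v \<in> J"
  using assms
proof (induction i arbitrary: j rule: less_induct)
  case (less i)
  define q :: nat where "q = 2 ^ n"
  show ?case
  proof (cases "i \<ge> 4 * q \<or> j \<ge> 4 * q")
    case True
    hence "x ^ i \<in> J \<or> y ^ j \<in> J"
      unfolding q_def using powers_J dvd_J le_imp_power_dvd by blast
    hence "t ^ 2^n * x ^ i * y ^ j + 0 \<in> J" by (auto intro: mult_J mult_J')
    thus ?thesis using bisums.zero by blast
  next
    case False
    obtain D where D: "D \<in> bisums x y t (q - 1) (4 * q)"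
      and DJ: "(x^3 + y^3) * (t ^ q * x ^ (2 * q) * y ^ (2 * q) + D) \<in> J"
      using leading_term_J unfolding q_def by blast
    \<comment> \<open>Here the degree \<open>6 * q + 2\<close> is decisive: both exponents are at
      most \<open>4 * q - 1\<close>, so both are at least \<open>2 * q + 3\<close>, which leaves
      room for \<open>x^3\<close> besides the leading monomial.\<close>
    obtain a b where ab: "i = 2 * q + 3 + a" "j = 2 * q + b"
      using False less.prems le_iff_add[of "2 * q + 3" i] le_iff_add[of "2 * q" j]
      unfolding q_def[symmetric] by auto
    obtain v where v: "v \<in> bisums x y t (q - 1) (6 * q + 2)"
      "t ^ q * x ^ (2 * q + a) * y ^ (j + 3) + v \<in> J"
      using less.IH[of "2 * q + a" "j + 3"] less.prems unfolding ab q_def by auto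
    have "x^3 + y^3 \<in> bisums x y t 0 3"
      using monom_in_bisums[of 0 0 3 0 3 t x y] monom_in_bisums[of 0 0 0 3 3 t x y]
      by (auto intro: bisums_add)
    moreover have "x ^ a * y ^ b \<in> bisums x y t 0 (a + b)"
      using monom_in_bisums[of 0 0 a b "a + b" t x y] by simp
    ultimately have mem: "x ^ a * y ^ b * ((x^3 + y^3) * D) \<in> bisums x y t (q - 1) (6 * q + 2)"
      using less.prems D unfolding ab q_def[symmetric]
      by (intro bisums_mono[OF bisums_mult[OF _ bisums_mult]]) auto
    have "t ^ q * x ^ i * y ^ j + (v + x ^ a * y ^ b * ((x^3 + y^3) * D))
      = (t ^ q * x ^ (2 * q + a) * y ^ (j + 3) + v)
        + x ^ a * y ^ b * ((x^3 + y^3) * (t ^ q * x ^ (2 * q) * y ^ (2 * q) + D))"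
      by (simp add: ab char2 algebra_simps power_add)
    also have "\<dots> \<in> J" by (intro add_J v(2) mult_J[OF DJ])
    finally show ?thesis using bisums_add[OF v(1) mem] unfolding q_def by blast
  qed
qed

text \<open>Under multiplication by \<open>t\<close> only monomials with \<open>k = 2^n - 1\<close>
  leave the span, and \<open>reduce_monom\<close> brings them back modulo \<open>J\<close>.\<close>

lemma reduce_bisum:
  assumes "v \<in> bisums x y t (2^n - 1) (6 * 2^n + 2)"
  shows "\<exists>w \<in> bisums x y t (2^n - 1) (6 * 2^n + 2). t * v + w \<in> J"
  using assms
proof induction
  case zero
  show ?case using bisums.zero zero_J by (intro bexI[of _ 0]) auto
next
  case (monom_add v k i j)
  then obtain w where w: "w \<in> bisums x y t (2^n - 1) (6 * 2^n + 2)" "t * v + w \<in> J" by blast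
  have "\<exists>u \<in> bisums x y t (2^n - 1) (6 * 2^n + 2). t ^ Suc k * x ^ i * y ^ j + u \<in> J"
  proof (cases "Suc k \<le> 2^n - 1")
    case True
    have "t ^ Suc k * x ^ i * y ^ j + t ^ Suc k * x ^ i * y ^ j \<in> J"
      by (simp add: double_eq_0[OF two] zero_J)
    thus ?thesis using monom_in_bisums[OF True monom_add.hyps(3)] by blast
  next
    case False
    hence "Suc k = 2^n" using monom_add.hyps(2) one_le_power[of "2::nat" n] by linarith
    thus ?thesis using reduce_monom[OF monom_add.hyps(3)] by simp
  qed
  then obtain u where u: "u \<in> bisums x y t (2^n - 1) (6 * 2^n + 2)" "t ^ Suc k * x ^ i * y ^ j + u \<in> J"
    by blast
  have "t * (t ^ k * x ^ i * y ^ j + v) + (u + w) = (t ^ Suc k * x ^ i * y ^ j + u) + (t * v + w)"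
    by (simp add: algebra_simps)
  thus ?case using u w by (metis add_J bisums_add)
qed

lemma reduce_power:
  assumes "v \<in> bisums x y t (2^n - 1) (6 * 2^n + 2)"
  shows "\<exists>w \<in> bisums x y t (2^n - 1) (6 * 2^n + 2). t ^ k * v + w \<in> J"
proof (induction k)
  case 0
  show ?case using assms by (auto simp: char2 zero_J intro!: bexI[of _ v])
next
  case (Suc k)
  then obtain w where w: "w \<in> bisums x y t (2^n - 1) (6 * 2^n + 2)" "t ^ k * v + w \<in> J" by blast
  obtain u where u: "u \<in> bisums x y t (2^n - 1) (6 * 2^n + 2)" "t * w + u \<in> J"
    using reduce_bisum[OF w(1)] by blast
  have "t ^ Suc k * v + u = t * (t ^ k * v + w) + (t * w + u)"
    by (simp add: char2 algebra_simps)
  thus ?case using u w(2) by (metis add_J mult_J)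
qed

text \<open>The saturation of \<open>J\<close> with respect to \<open>S\<close>: the elements that
  fall into the extension of \<open>J\<close> once \<open>S\<close> is inverted.\<close>

definition torsion :: "'a set" where
  "torsion = {v. \<exists>g\<in>S. g * v \<in> J}"

lemma J_torsion: "v \<in> J \<Longrightarrow> v \<in> torsion"
  \<comment> \<open>The binomial \<open>1 + t\<close> serves as an element of
    \<open>S\<close>.\<close>
  using binomial_S[of 0 1] mult_J by (auto simp: torsion_def)

lemma torsion_add: "u \<in> torsion \<Longrightarrow> v \<in> torsion \<Longrightarrow> u + v \<in> torsion"
proof -
  assume "u \<in> torsion" "v \<in> torsion"
  then obtain g h where gh: "g \<in> S" "h \<in> S" "g * u \<in> J" "h * v \<in> J" by (auto simp: torsion_def)
  have "g * h * (u + v) = h * (g * u) + g * (h * v)" by (simp add: algebra_simps)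
  also have "\<dots> \<in> J" by (intro add_J mult_J[OF gh(3)] mult_J[OF gh(4)])
  finally show ?thesis unfolding torsion_def using gh mult_S by blast
qed

lemma torsion_mult: "v \<in> torsion \<Longrightarrow> a * v \<in> torsion"
  by (auto simp: torsion_def mult.left_commute[of _ a] intro: mult_J)

text \<open>The remainders \<open>w k\<close> of \<open>t ^ k * v\<close> lie in a finite set, so
  two of them agree and cancel when the two congruences are added.\<close>

lemma bisum_torsion:
  assumes "v \<in> bisums x y t (2^n - 1) (6 * 2^n + 2)"
  shows "v \<in> torsion"
proof -
  obtain w where w: "w k \<in> bisums x y t (2^n - 1) (6 * 2^n + 2)" "t ^ k * v + w k \<in> J" for k
    using reduce_power[OF assms] by metis
  have "finite (range w)"
    using finite_bisums[OF two] by (rule finite_subset[rotated]) (use w in blast)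
  hence "\<not> inj w" using finite_imageD infinite_UNIV_nat by blast
  then obtain i j where ij: "i < j" "w i = w j" by (metis injI linorder_neqE_nat)
  have "(t ^ i + t ^ j) * v = (t ^ i * v + w i) + (t ^ j * v + w j)"
    by (simp add: ij char2 algebra_simps)
  also have "\<dots> \<in> J" by (intro add_J w)
  finally show ?thesis using binomial_S[OF ij(1)] by (auto simp: torsion_def)
qed

text \<open>The quartic is homogeneous of degree 4 in \<open>x\<close>, \<open>y\<close>,
  \<open>z\<close>, so rewriting \<open>z^4\<close> lowers \<open>k\<close> and keeps the degree.
  Once \<open>k \<le> 3\<close>, degree at least \<open>6 * 2^n + 2\<close> remains in
  \<open>x\<close> and \<open>y\<close>; this explains the bound \<open>6 * 2^n + 5\<close>.\<close>

lemma monom_torsion: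
  assumes "i + j + k \<ge> 6 * 2^n + 5"
  shows "x ^ i * y ^ j * z ^ k \<in> torsion"
  using assms
proof (induction k arbitrary: i j rule: less_induct)
  case (less k)
  show ?case
  proof (cases "k < 4")
    case True
    define a where "a = min i (6 * 2^n + 2)"
    define b where "b = 6 * 2^n + 2 - a"
    have ab: "a \<le> i" "b \<le> j" "a + b = 6 * 2^n + 2"
      using True less.prems by (auto simp: a_def b_def)
    have "x ^ a * y ^ b \<in> torsion"
      using bisum_torsion[OF monom_in_bisums[of 0 _ a b]] ab by simp
    hence "x ^ (i - a) * y ^ (j - b) * z ^ k * (x ^ a * y ^ b) \<in> torsion" by (rule torsion_mult)
    also have "x ^ (i - a) * y ^ (j - b) * z ^ k * (x ^ a * y ^ b)
        = x ^ (i - a + a) * y ^ (j - b + b) * z ^ k"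
      unfolding power_add by (simp add: ac_simps)
    finally show ?thesis using ab by simp
  next
    case False
    then obtain l where l: "k = l + 4" by (metis le_iff_add linorder_not_less add.commute)
    define r where "r = z^4 + x * y * z^2 + x^3 * z + y^3 * z + t * x^2 * y^2"
    have "x ^ i * y ^ j * z ^ k = x ^ i * y ^ j * z ^ l * r
        + x ^ (i + 1) * y ^ (j + 1) * z ^ (l + 2) + x ^ (i + 3) * y ^ j * z ^ (l + 1)
        + x ^ i * y ^ (j + 3) * z ^ (l + 1) + t * (x ^ (i + 2) * y ^ (j + 2) * z ^ l)"
      by (simp add: l r_def char2 algebra_simps power_add eval_nat_numeral)
    also have "\<dots> \<in> torsion"
      using less.prems l rel_J unfolding r_def
      by (intro torsion_add torsion_mult less.IH J_torsion) auto
    finally show ?thesis .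
  qed
qed

text \<open>The degree meets the bound of \<open>monom_torsion\<close> exactly, and the factor
  \<open>x^5\<close> does not depend on \<open>n\<close>, as tight closure demands.\<close>

lemma test_element_torsion: "x^5 * (y^3 * z^3) ^ 2^n \<in> torsion"
  using monom_torsion[of 5 "3 * 2^n" "3 * 2^n"]
  by (simp add: power_mult power_mult_distrib mult.assoc)

end


section \<open>Passage to the localization\<close>

context mult_subset
begin

lemma loc_frac_one_pow:
  "r \<in> carrier R \<Longrightarrow> loc_frac R S r \<one> [^]\<^bsub>localization R S\<^esub> (k :: nat) = loc_frac R S (r [^] k) \<one>"
proof (induction k)
  case 0
  show ?case by (simp add: loc_one nat_pow_def)
next
  case (Suc k)
  have "loc_frac R S r \<one> [^]\<^bsub>localization R S\<^esub> Suc k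
      = loc_frac R S r \<one> [^]\<^bsub>localization R S\<^esub> k \<otimes>\<^bsub>localization R S\<^esub> loc_frac R S r \<one>"
    by (simp add: nat_pow_def)
  thus ?case using Suc by (simp add: loc_mult_frac)
qed

lemma loc_frac_add_same_denom:
  assumes "a \<in> carrier R" "b \<in> carrier R" "s \<in> S"
  shows "loc_frac R S a s \<oplus>\<^bsub>localization R S\<^esub> loc_frac R S b s = loc_frac R S (a \<oplus> b) s"
proof -
  have "\<one> \<otimes> ((a \<otimes> s \<oplus> b \<otimes> s) \<otimes> s) = \<one> \<otimes> ((a \<oplus> b) \<otimes> (s \<otimes> s))"
    using assms S_carr[OF assms(3)] by algebra
  thus ?thesis
    using assms by (subst loc_add_frac) (auto simp: loc_frac_eq_iff intro!: bexI[OF _ one_S])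
qed

text \<open>The fraction is \<open>a / s\<close> times the \<open>q\<close>-th power of
  \<open>g / 1\<close>, so the denominator is absorbed into the coefficient.\<close>

lemma frac_mult_pow_in_frobenius_power:
  assumes "g \<in> I" "I \<subseteq> carrier R" "a \<in> carrier R" "s \<in> S"
  shows "loc_frac R S (a \<otimes> g [^] q) s \<in> frobenius_power (localization R S) (loc_ideal R S I) q"
proof -
  interpret loc: cring "localization R S" by (rule cring_localization)
  have g: "g \<in> carrier R" using assms by blast
  define G where "G = {h [^]\<^bsub>localization R S\<^esub> q | h. h \<in> loc_ideal R S I}"
  have sub: "G \<subseteq> carrier (localization R S)"
    unfolding G_def loc_ideal_def using assms(2) by (auto intro!: loc.nat_pow_closed loc_frac_closed)
  interpret id: ideal "Idl\<^bsub>localization R S\<^esub> G" "localization R S"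
    using sub by (rule loc.genideal_ideal)
  have "loc_frac R S g \<one> [^]\<^bsub>localization R S\<^esub> q \<in> G"
    unfolding G_def loc_ideal_def using assms(1) by blast
  hence "loc_frac R S (g [^] q) \<one> \<in> Idl\<^bsub>localization R S\<^esub> G"
    using loc.genideal_self[OF sub] loc_frac_one_pow[OF g] by auto
  hence "loc_frac R S a s \<otimes>\<^bsub>localization R S\<^esub> loc_frac R S (g [^] q) \<one> \<in> Idl\<^bsub>localization R S\<^esub> G"
    using assms by (intro id.I_l_closed) auto
  thus ?thesis using assms g by (simp add: loc_mult_frac frobenius_power_def G_def)
qed

end

section \<open>Residue classes of polynomials and the torsion result in
  \<open>L[x,y,z,t]\<close>\<close>

lemma cls_add: "cls g \<oplus>\<^bsub>A_ring\<^esub> cls h = cls (g + h)"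
  using ring_hom_add[OF cls_ring_hom, of g h] by (simp add: ring_of_type_algebra_def)

lemma cls_pow: "cls g [^]\<^bsub>A_ring\<^esub> (k :: nat) = cls (g ^ k)"
  by (induction k) (simp_all add: nat_pow_def cls_one cls_mult mult.commute)

lemma cls_eq_iff: "cls g = cls h \<longleftrightarrow> rel_poly dvd g - h"
proof -
  interpret cring A_ring by (rule cring_A_ring)
  have "cls g = cls ((g - h) + h)" by simp
  also have "\<dots> = cls (g - h) \<oplus>\<^bsub>A_ring\<^esub> cls h" by (simp only: cls_add)
  finally have "cls g = cls h \<longleftrightarrow> cls (g - h) = \<zero>\<^bsub>A_ring\<^esub>"
    by (metis add.r_cancel_one' cls_closed)
  thus ?thesis by (simp add: cls_eq_zero_iff)
qed

lemma L_char2: "1 + 1 = (0 :: L)"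
proof -
  have "to_ac (1 + 1 :: bit) = 0" by (simp only: one_add_one bit_2_eq_0 to_ac_0)
  thus ?thesis by (simp only: to_ac_add to_ac_1)
qed

text \<open>The torsion result with membership in \<open>J\<close> unfolded to explicit
  coefficients. The denominator \<open>g\<close> may depend on \<open>e\<close>; it becomes a unit
  in the localization.\<close>

lemma torsion_witness:
  "\<exists>g a b c. g \<noteq> 0 \<and> rel_poly dvd const_t g * (xv^5 * (yv^3 * zv^3) ^ 2^e)
     - (a * (xv^4) ^ 2^e + b * (yv^4) ^ 2^e + c * (zv^4) ^ 2^e)"
proof -
  have two: "1 + 1 = (0 :: Lxyzt)"
    by (simp add: one_pCons L_char2 del: one_add_one)
  define J where "J = {v. \<exists>a b c. rel_poly dvd v - (a * (xv^4) ^ 2^e + b * (yv^4) ^ 2^e + c * (zv^4) ^ 2^e)}"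
  interpret quartic_frobenius_ideal xv yv zv tv J "{const_t g | g. g \<noteq> 0}" e
  proof
    show "1 + 1 = (0 :: Lxyzt)" by (rule two)
    show "0 \<in> J" unfolding J_def by (auto intro!: exI[of _ 0])
  next
    fix u v assume "u \<in> J" "v \<in> J"
    then obtain a b c a' b' c' where
      "rel_poly dvd u - (a * (xv^4) ^ 2^e + b * (yv^4) ^ 2^e + c * (zv^4) ^ 2^e)"
      "rel_poly dvd v - (a' * (xv^4) ^ 2^e + b' * (yv^4) ^ 2^e + c' * (zv^4) ^ 2^e)"
      unfolding J_def by blast
    from dvd_add[OF this] show "u + v \<in> J" unfolding J_def
      by (intro CollectI exI[of _ "a + a'"] exI[of _ "b + b'"] exI[of _ "c + c'"])
         (simp add: algebra_simps)
  next
    fix v a' assume "v \<in> J"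
    then obtain a b c where
      "rel_poly dvd v - (a * (xv^4) ^ 2^e + b * (yv^4) ^ 2^e + c * (zv^4) ^ 2^e)"
      unfolding J_def by blast
    from dvd_mult[OF this, of a'] show "a' * v \<in> J" unfolding J_def
      by (intro CollectI exI[of _ "a' * a"] exI[of _ "a' * b"] exI[of _ "a' * c"])
         (simp add: algebra_simps)
  next
    show "xv ^ (4 * 2^e) \<in> J" unfolding J_def
      by (intro CollectI exI[of _ 1] exI[of _ 0] exI[of _ 0]) (simp add: power_mult)
    show "yv ^ (4 * 2^e) \<in> J" unfolding J_def
      by (intro CollectI exI[of _ 0] exI[of _ 1] exI[of _ 0]) (simp add: power_mult)
    show "zv ^ (4 * 2^e) \<in> J" unfolding J_def
      by (intro CollectI exI[of _ 0] exI[of _ 0] exI[of _ 1]) (simp add: power_mult)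
    show "zv^4 + xv * yv * zv^2 + xv^3 * zv + yv^3 * zv + tv * xv^2 * yv^2 \<in> J"
      unfolding J_def by (auto intro!: exI[of _ 0] simp flip: rel_poly_def)
  next
    fix g h assume "g \<in> {const_t g | g. g \<noteq> 0}" "h \<in> {const_t g | g. g \<noteq> 0}"
    then obtain g' h' where "g = const_t g'" "h = const_t h'" "g' \<noteq> 0" "h' \<noteq> 0" by blast
    thus "g * h \<in> {const_t g | g. g \<noteq> 0}"
      by (auto intro!: exI[of _ "g' * h'"] simp: const_t_def)
  next
    fix i j :: nat assume "i < j"
    have tv: "tv ^ k = const_t (monom 1 k)" for k
      by (induction k) (auto simp: tv_def const_t_def one_pCons monom_0 monom_Suc)
    \<comment> \<open>Since \<open>i\<close> and \<open>j\<close> differ, the two powers of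
      \<open>t\<close> cannot cancel.\<close>
    have "coeff (monom 1 i + monom 1 j :: L poly) i \<noteq> 0" using \<open>i < j\<close> by simp
    hence "monom 1 i + monom 1 j \<noteq> (0 :: L poly)" by (metis coeff_0)
    thus "tv ^ i + tv ^ j \<in> {const_t g | g. g \<noteq> 0}"
      by (auto simp: tv const_t_def intro!: exI[of _ "monom 1 i + monom 1 j"])
  qed
  show ?thesis using test_element_torsion unfolding torsion_def unfolding J_def by blast
qed

theorem theorem2p4:
  shows "loc_frac A_ring S_A f_A \<one>\<^bsub>A_ring\<^esub> \<in> tight_closure 2 (localization A_ring S_A) (loc_ideal A_ring S_A I_A)"
proof -
  interpret A: mult_subset A_ring S_A by (rule mult_subset_S_A)
  interpret loc: cring "localization A_ring S_A" by (rule A.cring_localization)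
  let ?l = "\<lambda>g s. loc_frac A_ring S_A (cls g) (cls s)"
  define f where "f = yv^3 * zv^3"
  have f_A: "f_A = cls f" by (simp add: f_A_def f_def cls_pow cls_mult)
  have cls1: "cls 1 \<in> S_A" using A.one_S by (simp add: cls_one)
  have c_nz: "?l (xv^5) 1 \<noteq> \<zero>\<^bsub>localization A_ring S_A\<^esub>"
  proof
    assume "?l (xv^5) 1 = \<zero>\<^bsub>localization A_ring S_A\<^esub>"
    then obtain u where u: "u \<in> S_A" "u \<otimes>\<^bsub>A_ring\<^esub> cls (xv^5) = \<zero>\<^bsub>A_ring\<^esub>"
      using cls1 A.S_carr
      by (auto simp: A.loc_zero A.loc_frac_eq_iff cls_one cls_mult)
    then obtain g where g: "g \<noteq> 0" "rel_poly dvd const_t g * xv^5"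
      by (auto simp: S_A_def cls_mult cls_eq_zero_iff)
    \<comment> \<open>The multiple of \<open>xv^5\<close> is nonzero and of degree 0 in
      \<open>z\<close>, while the relation has degree 4 in \<open>z\<close> and so cannot divide
      it.\<close>
    define h :: "L poly poly poly" where "h = [:[:g:]:] * [:[:0, 1:]:] ^ 5"
    have "const_t g * xv^5 = [:h:]"
      by (simp add: h_def const_t_def xv_def poly_const_pow)
    moreover have "h \<noteq> 0" using g(1) by (simp add: h_def)
    ultimately show False using dvd_imp_degree_le[OF g(2)] by (simp add: degree_rel_poly)
  qed
  have I: "I_A \<subseteq> carrier A_ring" "cls (xv^4) \<in> I_A" "cls (yv^4) \<in> I_A" "cls (zv^4) \<in> I_A"
  proof -
    have sub: "{cls (xv^4), cls (yv^4), cls (zv^4)} \<subseteq> carrier A_ring" by auto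
    show "I_A \<subseteq> carrier A_ring"
      using A.genideal_ideal[OF sub] by (auto simp: I_A_def cls_pow dest: ideal.Icarr)
    show "cls (xv^4) \<in> I_A" "cls (yv^4) \<in> I_A" "cls (zv^4) \<in> I_A"
      using A.genideal_self[OF sub] by (auto simp: I_A_def cls_pow)
  qed
  have "?l (xv^5) 1 \<otimes>\<^bsub>localization A_ring S_A\<^esub> ?l f 1 [^]\<^bsub>localization A_ring S_A\<^esub> ((2::nat) ^ e)
     \<in> frobenius_power (localization A_ring S_A) (loc_ideal A_ring S_A I_A) (2 ^ e)" for e
  proof -
    define F where "F = frobenius_power (localization A_ring S_A) (loc_ideal A_ring S_A I_A) (2 ^ e)"
    have "{g [^]\<^bsub>localization A_ring S_A\<^esub> ((2::nat) ^ e) | g. g \<in> loc_ideal A_ring S_A I_A}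
        \<subseteq> carrier (localization A_ring S_A)"
      using I(1) by (auto simp: loc_ideal_def intro!: loc.nat_pow_closed A.loc_frac_closed)
    then interpret F: ideal F "localization A_ring S_A"
      unfolding F_def frobenius_power_def by (rule loc.genideal_ideal)
    obtain g a b c where g: "g \<noteq> 0" and
      "rel_poly dvd const_t g * (xv^5 * f ^ 2^e) - (a * (xv^4) ^ 2^e + b * (yv^4) ^ 2^e + c * (zv^4) ^ 2^e)"
      using torsion_witness unfolding f_def by blast
    hence eq: "cls (const_t g * (xv^5 * f ^ 2^e)) = cls (a * (xv^4) ^ 2^e + b * (yv^4) ^ 2^e + c * (zv^4) ^ 2^e)"
      by (simp add: cls_eq_iff)
    have s: "cls (const_t g) \<in> S_A" using g by (auto simp: S_A_def)
    \<comment> \<open>Expanding the fraction by \<open>const_t g\<close> turns the numerator into a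
      combination of the powers of the generators.\<close>
    have "?l (xv^5 * f ^ 2^e) 1 = ?l (const_t g * (xv^5 * f ^ 2^e)) (const_t g)"
      using s A.one_S
      by (subst A.loc_frac_eq_iff) (auto simp: cls_one cls_mult mult.commute)
    also have "\<dots> = ?l (a * (xv^4) ^ 2^e) (const_t g) \<oplus>\<^bsub>localization A_ring S_A\<^esub>
      ?l (b * (yv^4) ^ 2^e) (const_t g) \<oplus>\<^bsub>localization A_ring S_A\<^esub> ?l (c * (zv^4) ^ 2^e) (const_t g)"
      unfolding eq using s by (simp add: A.loc_frac_add_same_denom cls_add)
    also have "\<dots> \<in> F"
      using A.frac_mult_pow_in_frobenius_power[OF I(2) I(1) cls_closed[of a] s, of "2^e"]
        A.frac_mult_pow_in_frobenius_power[OF I(3) I(1) cls_closed[of b] s, of "2^e"]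
        A.frac_mult_pow_in_frobenius_power[OF I(4) I(1) cls_closed[of c] s, of "2^e"]
      unfolding F_def[symmetric] cls_pow cls_mult by (intro F.a_closed)
    also have "?l (xv^5 * f ^ 2^e) 1 = ?l (xv^5) 1 \<otimes>\<^bsub>localization A_ring S_A\<^esub> ?l (f ^ 2^e) 1"
      using cls1 by (simp add: A.loc_mult_frac cls_mult)
    also have "?l (f ^ 2^e) 1 = ?l f 1 [^]\<^bsub>localization A_ring S_A\<^esub> ((2::nat) ^ e)"
      using A.loc_frac_one_pow[OF cls_closed, of f "2^e"] by (simp add: cls_one cls_pow)
    finally show ?thesis unfolding F_def .
  qed
  moreover have "?l f 1 = loc_frac A_ring S_A f_A \<one>\<^bsub>A_ring\<^esub>" by (simp add: f_A cls_one)
  moreover have "?l f 1 \<in> carrier (localization A_ring S_A)" "?l (xv^5) 1 \<in> carrier (localization A_ring S_A)"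
    using A.one_S by (auto simp: cls_one)
  ultimately show ?thesis using c_nz unfolding tight_closure_def by auto
qed

end
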